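(* Suppose $A_4(\alpha_0,\dots,\alpha_4)$ has a rational solution $(f_0,\dots,f_4)$ (indices modulo 5). Then: (1) if the solution is of Type A, then $\alpha_i\in\mathbb{Z}$ for all $0\le i\le4$; (2) if the solution is of Type B, then for some $i\in\{0,\dots,4\}$, $(\alpha_i,\alpha_{i+1},\alpha_{i+2},\alpha_{i+3},\alpha_{i+4})\equiv\left(\frac{n_1}3-\frac{n_3}3,\ \frac{n_1}3,\ \frac{n_1}3+\frac{n_4}3,\ \frac{n_3}3,\ -\frac{n_4}3\right)\pmod{\mathbb{Z}}$ for some $n_1,n_3,n_4\in\{0,1,2\}$; (3) if the solution is of Type C, then for some $i\in\{0,\dots,4\}$, $(\alpha_i,\alpha_{i+1},\alpha_{i+2},\alpha_{i+3},\alpha_{i+4})\equiv\left(\frac{n_1}5+\frac{2n_2}5+\frac{3n_3}5,\ \frac{n_1}5+\frac{2n_2}5+\frac{n_3}5,\ \frac{n_1}5,\ \frac{n_1}5+\frac{n_2}5,\ \frac{n_1}5+\frac{n_3}5\right)\pmod{\mathbb{Z}}$ for some $n_1,n_2,n_3\in\{0,1,2,3,4\}$.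
   Context: The $A_4^{(1)}$ Painlevé equation $A_4(\alpha_0,\dots,\alpha_4)$ with complex parameters $\alpha_j$ is the system for five functions $f_0,\dots,f_4$ of $t$ (indices in $\mathbb{Z}/5\mathbb{Z}$, ${}'=d/dt$): $f_j'=f_j(f_{j+1}-f_{j+2}+f_{j+3}-f_{j+4})+\alpha_j$ ($j=0,\dots,4$), $f_0+\dots+f_4=t$; hence $\sum_j\alpha_j=1$. A rational solution is a tuple of rational functions of $t$ satisfying it. Since $\sum f_j=t$, some $f_j$ has a pole at $t=\infty$, and (as shown in the paper) every rational solution is of exactly one of the following types: Type A(1) with index $i$: $f_i$ has a pole at $t=\infty$ and the other $f_j$ are regular there; Type A(2) with index $i$: $f_i,f_{i+1},f_{i+3}$ have a pole at $t=\infty$ and $f_{i+2},f_{i+4}$ are regular there; Type B with index $i$: $f_i,f_{i+1},f_{i+2}$ have a pole at $t=\infty$ and $f_{i+3},f_{i+4}$ are regular there; Type C: all $f_j$ have a pole at $t=\infty$. "Type A" means Type A(1) or Type A(2). *)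

theory Defs
  imports "HOL-Analysis.Analysis" "HOL-Computational_Algebra.Polynomial"
begin

definition rat_fun :: "(complex \<Rightarrow> complex) \<Rightarrow> bool" where
  "rat_fun f \<longleftrightarrow> (\<exists>p q. q \<noteq> 0 \<and> (\<forall>z. poly q z \<noteq> 0 \<longrightarrow> f z = poly p z / poly q z))"

definition pole_inf :: "(complex \<Rightarrow> complex) \<Rightarrow> bool" where
  "pole_inf f \<longleftrightarrow> filterlim f at_infinity at_infinity"

text \<open>Indices of f and alpha are taken modulo 5, only 0..4 are used.
  A rational solution of A4(alpha_0..alpha_4): each f_j rational, and the system holds
  identically (i.e. away from a finite set of points).\<close>
definition A4_rational_solution :: "(nat \<Rightarrow> complex) \<Rightarrow> (nat \<Rightarrow> complex \<Rightarrow> complex) \<Rightarrow> bool" where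
  "A4_rational_solution \<alpha> f \<longleftrightarrow>
     (\<forall>j<5. rat_fun (f j)) \<and>
     (\<exists>S. finite S \<and> (\<forall>t. t \<notin> S \<longrightarrow>
        (\<forall>j<5. (f j has_field_derivative
            (f j t * (f ((j+1) mod 5) t - f ((j+2) mod 5) t + f ((j+3) mod 5) t - f ((j+4) mod 5) t) + \<alpha> j))
            (at t)) \<and>
        (\<Sum>j<5. f j t) = t))"

definition typeA1 :: "(nat \<Rightarrow> complex \<Rightarrow> complex) \<Rightarrow> nat \<Rightarrow> bool" where
  "typeA1 f i \<longleftrightarrow> pole_inf (f i) \<and> (\<forall>k\<in>{1,2,3,4}. \<not> pole_inf (f ((i+k) mod 5)))"

definition typeA2 :: "(nat \<Rightarrow> complex \<Rightarrow> complex) \<Rightarrow> nat \<Rightarrow> bool" where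
  "typeA2 f i \<longleftrightarrow> (\<forall>k\<in>{0,1,3}. pole_inf (f ((i+k) mod 5))) \<and> (\<forall>k\<in>{2,4}. \<not> pole_inf (f ((i+k) mod 5)))"

definition typeB :: "(nat \<Rightarrow> complex \<Rightarrow> complex) \<Rightarrow> nat \<Rightarrow> bool" where
  "typeB f i \<longleftrightarrow> (\<forall>k\<in>{0,1,2}. pole_inf (f ((i+k) mod 5))) \<and> (\<forall>k\<in>{3,4}. \<not> pole_inf (f ((i+k) mod 5)))"

definition typeC :: "(nat \<Rightarrow> complex \<Rightarrow> complex) \<Rightarrow> bool" where
  "typeC f \<longleftrightarrow> (\<forall>j<5. pole_inf (f j))"

definition typeA :: "(nat \<Rightarrow> complex \<Rightarrow> complex) \<Rightarrow> bool" where
  "typeA f \<longleftrightarrow> (\<exists>i<5. typeA1 f i \<or> typeA2 f i)"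

definition cong_Z :: "complex \<Rightarrow> complex \<Rightarrow> bool" where
  "cong_Z a b \<longleftrightarrow> a - b \<in> \<int>"

end

theory Submission
  imports Defs "HOL-Computational_Algebra.Fundamental_Theorem_Algebra"
begin

text \<open>Write \<open>L\<^sub>j(v) = v\<^sub>j\<^sub>+\<^sub>1 - v\<^sub>j\<^sub>+\<^sub>2 + v\<^sub>j\<^sub>+\<^sub>3 - v\<^sub>j\<^sub>+\<^sub>4\<close>. The system \<open>v\<^sub>j L\<^sub>j(v) = 0\<close>, \<open>\<Sum> v\<^sub>j = 0\<close> has only the
  zero solution. With a reduced common denominator, \<open>f\<^sub>j = p\<^sub>j / Q\<close>, evaluating the equations at a
  root \<open>c\<close> of \<open>Q\<close> gives \<open>p\<^sub>j(c) (L\<^sub>j(p(c)) + Q'(c)) = 0\<close> and \<open>\<Sum> p\<^sub>j(c) = 0\<close>. Hence \<open>Q'(c) \<noteq> 0\<close>,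
  so all finite poles are simple, and the residues satisfy \<open>r\<^sub>j (L\<^sub>j(r) + 1) = 0\<close>, \<open>\<Sum> r\<^sub>j = 0\<close>, which
  forces them to be integers. The same linear algebra applied to leading coefficients shows that the pole
  at infinity has order at most one. Therefore \<open>f\<^sub>j = a\<^sub>j t + b\<^sub>j + c\<^sub>j / t + \<dots>\<close> where \<open>c\<^sub>j\<close> is the sum of
  the finite residues, an integer. The type of the solution determines the \<open>a\<^sub>j\<close>, and the constant terms
  of the equations give \<open>\<alpha>\<^sub>j = a\<^sub>j - a\<^sub>j L\<^sub>j(c) - c\<^sub>j L\<^sub>j(a)\<close>; together with \<open>\<Sum> c\<^sub>j = 0\<close> this yields the
  congruences.\<close>

subsection \<open>The alternating cyclic form\<close>

text \<open>Generic in the value type because it is applied to real and complex vectors, to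
  residues, and to tuples of polynomials.\<close>

definition cyc_alt :: "(nat \<Rightarrow> 'a::ab_group_add) \<Rightarrow> nat \<Rightarrow> 'a" where
  "cyc_alt v j = v ((j+1) mod 5) - v ((j+2) mod 5) + v ((j+3) mod 5) - v ((j+4) mod 5)"

lemma less_5_iff: "j < (5::nat) \<longleftrightarrow> j = 0 \<or> j = 1 \<or> j = 2 \<or> j = 3 \<or> j = 4"
  by linarith

lemma all_less_5: "(\<forall>j<5. P j) \<longleftrightarrow> P 0 \<and> P 1 \<and> P 2 \<and> P 3 \<and> P (4::nat)"
  by (auto simp: less_5_iff)

lemma sum_less_5: "(\<Sum>j<5. v j) = v 0 + v 1 + v 2 + v 3 + v (4::nat)"
  for v :: "nat \<Rightarrow> 'a::comm_monoid_add"
  by (simp add: eval_nat_numeral add.assoc)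

lemma cyc_alt_simps:
  "cyc_alt v 0 = v 1 - v 2 + v 3 - v 4"
  "cyc_alt v 1 = v 2 - v 3 + v 4 - v 0"
  "cyc_alt v 2 = v 3 - v 4 + v 0 - v 1"
  "cyc_alt v 3 = v 4 - v 0 + v 1 - v 2"
  "cyc_alt v 4 = v 0 - v 1 + v 2 - v 3"
  by (simp_all add: cyc_alt_def numeral_2_eq_2)

lemma poly_cyc_alt: "poly (cyc_alt p j) z = cyc_alt (\<lambda>k. poly (p k) z) j"
  for z :: "'a::comm_ring_1"
  by (simp add: cyc_alt_def)

lemma coeff_cyc_alt: "coeff (cyc_alt p j) n = cyc_alt (\<lambda>k. coeff (p k) n) j"
  for p :: "nat \<Rightarrow> 'a::ab_group_add poly"
  by (simp add: cyc_alt_def)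

lemma cyc_alt_divide: "cyc_alt (\<lambda>k. v k / c) j = cyc_alt v j / c" for c :: complex
  by (simp add: cyc_alt_def diff_divide_distrib add_divide_distrib)

text \<open>Up to rotation of the indices the nonzero solutions are \<open>e (1, -1, 0, 0, 0)\<close>,
  \<open>e (-1, 0, 1, 0, 0)\<close> and \<open>e (3, 1, -1, -3, 0)\<close>.\<close>
lemma cyc_alt_real_values:
  fixes x :: "nat \<Rightarrow> real"
  assumes "\<forall>j<5. x j = 0 \<or> cyc_alt x j = - e" and "(\<Sum>j<5. x j) = 0"
  shows "\<forall>j<5. x j \<in> {0, e, - e, 3 * e, - (3 * e)}"
proof -
  \<comment> \<open>Only the first coordinate is treated. The hypotheses are invariant under cyclic
    shifts, so the other coordinates follow by instantiating \<open>*\<close> with rotated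
    equations.\<close>
  have *: "x0 = 0 \<or> x0 = e \<or> x0 = - e \<or> x0 = 3 * e \<or> x0 = - (3 * e)"
    if "x0 = 0 \<or> x1 - x2 + x3 - x4 = - e" "x1 = 0 \<or> x2 - x3 + x4 - x0 = - e"
       "x2 = 0 \<or> x3 - x4 + x0 - x1 = - e" "x3 = 0 \<or> x4 - x0 + x1 - x2 = - e"
       "x4 = 0 \<or> x0 - x1 + x2 - x3 = - e" "x0 + x1 + x2 + x3 + x4 = 0"
    for x0 x1 x2 x3 x4 :: real
  proof (cases "x0 = 0")
    case False
    \<comment> \<open>As \<open>x0\<close> is nonzero, the first alternative is a linear equation.
      Each choice among the other four alternatives gives a linear system that determines
      \<open>x0\<close> or is contradictory.\<close>
    with that show ?thesis by (elim disjE) simp_all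
  qed simp
  have eqs: "x 0 = 0 \<or> x 1 - x 2 + x 3 - x 4 = - e" "x 1 = 0 \<or> x 2 - x 3 + x 4 - x 0 = - e"
       "x 2 = 0 \<or> x 3 - x 4 + x 0 - x 1 = - e" "x 3 = 0 \<or> x 4 - x 0 + x 1 - x 2 = - e"
       "x 4 = 0 \<or> x 0 - x 1 + x 2 - x 3 = - e"
    using assms(1) unfolding all_less_5 cyc_alt_simps by blast+
  have sum: "x 0 + x 1 + x 2 + x 3 + x 4 = 0"
    using assms(2) by (simp only: sum_less_5)
  show ?thesis
    unfolding all_less_5 insert_iff empty_iff simp_thms
    by (intro conjI; rule *[OF eqs sum] *[OF eqs(2,3,4,5,1)] *[OF eqs(3,4,5,1,2)]
        *[OF eqs(4,5,1,2,3)] *[OF eqs(5,1,2,3,4)]; use sum in linarith)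
qed

text \<open>The form has real coefficients and \<open>e\<close> is real, so the system splits: the
  real parts solve it with the same \<open>e\<close>, the imaginary parts with 0 in place of
  \<open>e\<close>, which forces them to vanish.\<close>

lemma cyc_alt_complex_values:
  fixes x :: "nat \<Rightarrow> complex" and e :: real
  assumes "\<forall>j<5. x j * (cyc_alt x j + of_real e) = 0" and "(\<Sum>j<5. x j) = 0"
  shows "\<forall>j<5. Im (x j) = 0 \<and> Re (x j) \<in> {0, e, - e, 3 * e, - (3 * e)}"
proof -
  have *: "x j = 0 \<or> cyc_alt x j = - of_real e" if "j < 5" for j
    using assms(1) that by (auto simp: add_eq_0_iff2)
  have "Re (cyc_alt x j) = cyc_alt (\<lambda>k. Re (x k)) j"
       "Im (cyc_alt x j) = cyc_alt (\<lambda>k. Im (x k)) j" for j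
    by (simp_all add: cyc_alt_def)
  with * have "\<forall>j<5. Re (x j) = 0 \<or> cyc_alt (\<lambda>k. Re (x k)) j = - e"
    and "\<forall>j<5. Im (x j) = 0 \<or> cyc_alt (\<lambda>k. Im (x k)) j = - 0"
    by (metis Re_complex_of_real uminus_complex.sel(1) zero_complex.sel(1),
        metis Im_complex_of_real uminus_complex.sel(2) zero_complex.sel(2))
  moreover have "(\<Sum>j<5. Re (x j)) = 0" "(\<Sum>j<5. Im (x j)) = 0"
    using assms(2) by (simp_all flip: Re_sum Im_sum)
  ultimately show ?thesis
    using cyc_alt_real_values[of "\<lambda>k. Re (x k)" e] cyc_alt_real_values[of "\<lambda>k. Im (x k)" 0] by simp
qed

text \<open>The case \<open>e = 0\<close>. It excludes both multiple roots of the denominator and a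
  pole of order above one at infinity.\<close>

corollary cyc_alt_homogeneous_zero:
  fixes x :: "nat \<Rightarrow> complex"
  assumes "\<forall>j<5. x j * cyc_alt x j = 0" and "(\<Sum>j<5. x j) = 0" and "j < 5"
  shows "x j = 0"
  using cyc_alt_complex_values[of x 0] assms by (simp add: complex_eq_iff)

text \<open>The case \<open>e = 1\<close>, which is the system satisfied by the residues at a simple
  finite pole.\<close>

corollary cyc_alt_residues_Ints:
  fixes x :: "nat \<Rightarrow> complex"
  assumes "\<forall>j<5. x j * (cyc_alt x j + 1) = 0" and "(\<Sum>j<5. x j) = 0" and "j < 5"
  shows "x j \<in> \<int>"
proof -
  have "Im (x j) = 0" "Re (x j) \<in> {0, 1, - 1, 3, - 3}"
    using cyc_alt_complex_values[of x 1] assms by simp_all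
  then have "x j = of_real (Re (x j))" "Re (x j) \<in> \<int>"
    by (auto simp: complex_eq_iff)
  then show ?thesis
    by (metis Ints_of_real)
qed

section \<open>Comparison of complex polynomials and of top coefficients\<close>

lemma poly_eqI_cofinite:
  fixes p q :: "complex poly"
  assumes "finite S" and "\<And>z. z \<notin> S \<Longrightarrow> poly p z = poly q z"
  shows "p = q"
proof (rule ccontr)
  assume "p \<noteq> q"
  then have "finite {z. poly (p - q) z = 0}"
    by (intro poly_roots_finite) simp
  moreover have "UNIV \<subseteq> S \<union> {z. poly (p - q) z = 0}"
    using assms(2) by auto
  ultimately show False
    using assms(1) infinite_UNIV_char_0[where 'a = complex] by (meson finite_UnI finite_subset)
qed

lemma coeff_mult_add_le:
  fixes p q :: "'a::comm_semiring_0 poly"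
  assumes "degree p \<le> m" "degree q \<le> n"
  shows "coeff (p * q) (m + n) = coeff p m * coeff q n"
proof (cases "degree p = m \<and> degree q = n")
  case True
  then show ?thesis using coeff_mult_degree_sum by blast
next
  case False
  then have "degree p < m \<or> degree q < n" using assms by auto
  moreover from this have "degree (p * q) < m + n"
    using degree_mult_le[of p q] assms by linarith
  ultimately show ?thesis by (auto simp: coeff_eq_0)
qed

subsection \<open>Poles of rational solutions\<close>

text \<open>The exceptional set may be larger than the root set of \<open>Q\<close>: after a common
  factor is cancelled at \<open>c\<close>, the value of \<open>f j\<close> at \<open>c\<close>
  itself remains unknown.\<close>

definition common_denominator ::
    "(nat \<Rightarrow> complex \<Rightarrow> complex) \<Rightarrow> complex poly \<Rightarrow> (nat \<Rightarrow> complex poly) \<Rightarrow> bool" where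
  "common_denominator f Q p \<longleftrightarrow> Q \<noteq> 0 \<and>
     (\<exists>S. finite S \<and> (\<forall>z. z \<notin> S \<longrightarrow> poly Q z \<noteq> 0 \<and> (\<forall>j<5. f j z = poly (p j) z / poly Q z)))"

lemma common_denominator_exists:
  assumes "\<forall>j<5. rat_fun (f j)"
  shows "\<exists>Q p. common_denominator f Q p"
proof -
  obtain p q where pq: "\<And>j. j < 5 \<Longrightarrow> q j \<noteq> 0"
      "\<And>j z. j < 5 \<Longrightarrow> poly (q j) z \<noteq> 0 \<Longrightarrow> f j z = poly (p j) z / poly (q j) z"
    using assms unfolding rat_fun_def by metis
  define Q where "Q = (\<Prod>j<5. q j)"
  have "Q \<noteq> 0" using pq(1) by (simp add: Q_def)
  have "f j z = poly (p j * (\<Prod>k\<in>{..<5} - {j}. q k)) z / poly Q z"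
    if "j < 5" "poly Q z \<noteq> 0" for j z
  proof -
    have Q: "Q = q j * (\<Prod>k\<in>{..<5} - {j}. q k)"
      using that by (simp add: Q_def prod.remove)
    with that show ?thesis using pq(2)[of j z] by simp
  qed
  then have "common_denominator f Q (\<lambda>j. p j * (\<Prod>k\<in>{..<5} - {j}. q k))"
    unfolding common_denominator_def using \<open>Q \<noteq> 0\<close> poly_roots_finite
    by (intro conjI exI[of _ "{z. poly Q z = 0}"]) auto
  then show ?thesis by blast
qed

text \<open>A denominator of least degree works: if all numerators vanished at a root
  \<open>c\<close> of \<open>Q\<close>, cancelling the common linear factor would lower the degree.
  The single fractions need not be reduced; only the vector of numerators has to be nonzero at each
  root.\<close>

lemma reduced_denominator_exists:
  assumes "\<forall>j<5. rat_fun (f j)"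
  shows "\<exists>Q p. common_denominator f Q p \<and> (\<forall>c. poly Q c = 0 \<longrightarrow> (\<exists>j<5. poly (p j) c \<noteq> 0))"
proof -
  obtain Q where ex: "\<exists>p. common_denominator f Q p"
    and min: "\<And>Q'. \<exists>p. common_denominator f Q' p \<Longrightarrow> degree Q \<le> degree Q'"
    using common_denominator_exists[OF assms] ex_has_least_nat[of "\<lambda>Q. \<exists>p. common_denominator f Q p" _ degree]
    by metis
  from ex obtain p where p: "common_denominator f Q p" by blast
  have "\<exists>j<5. poly (p j) c \<noteq> 0" if "poly Q c = 0" for c
  proof (rule ccontr)
    assume "\<not> (\<exists>j<5. poly (p j) c \<noteq> 0)"
    then have "\<forall>j<5. [:-c, 1:] dvd p j" by (simp add: poly_eq_0_iff_dvd)
    then obtain p' where p': "\<And>j. j < 5 \<Longrightarrow> p j = [:-c, 1:] * p' j"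
      unfolding dvd_def by metis
    from that obtain Q' where Q': "Q = [:-c, 1:] * Q'"
      by (auto simp: poly_eq_0_iff_dvd dvd_def)
    obtain S where S: "Q \<noteq> 0" "finite S"
      "\<And>z. z \<notin> S \<Longrightarrow> poly Q z \<noteq> 0 \<and> (\<forall>j<5. f j z = poly (p j) z / poly Q z)"
      using p unfolding common_denominator_def by blast
    have "f j z = poly (p' j) z / poly Q' z \<and> poly Q' z \<noteq> 0" if "j < 5" "z \<notin> insert c S" for j z
    proof -
      have "poly Q z = (z - c) * poly Q' z" "poly (p j) z = (z - c) * poly (p' j) z"
        unfolding Q' p'[OF \<open>j < 5\<close>] poly_mult by simp_all
      moreover have "z - c \<noteq> 0" "poly Q z \<noteq> 0" "f j z = poly (p j) z / poly Q z"
        using S(3)[of z] that by auto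
      ultimately show ?thesis by simp
    qed
    then have "common_denominator f Q' p'"
      unfolding common_denominator_def using S(1,2) Q'
      by (intro conjI exI[of _ "insert c S"]) fastforce+
    then have "degree Q \<le> degree Q'" using min by blast
    moreover have "degree Q = Suc (degree Q')"
      using Q' S(1) by (simp add: degree_mult_eq del: mult_pCons_left)
    ultimately show False by simp
  qed
  with p show ?thesis by blast
qed

text \<open>Multiplying the system by \<open>Q * Q\<close> (and the sum condition by
  \<open>Q\<close>) gives polynomial equations valid off a finite set, hence identically.\<close>

lemma A4_polynomial_system:
  assumes "A4_rational_solution \<alpha> f" and "common_denominator f Q p"
  shows "\<forall>j<5. Q * pderiv (p j) - p j * pderiv Q = p j * cyc_alt p j + smult (\<alpha> j) (Q * Q)"
    and "(\<Sum>j<5. p j) = [:0, 1:] * Q"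
proof -
  obtain S where S: "finite S"
    "\<And>z. z \<notin> S \<Longrightarrow> poly Q z \<noteq> 0 \<and> (\<forall>j<5. f j z = poly (p j) z / poly Q z)"
    using assms(2) unfolding common_denominator_def by blast
  obtain T where T: "finite T"
    "\<And>z j. z \<notin> T \<Longrightarrow> j < 5 \<Longrightarrow> (f j has_field_derivative
        f j z * cyc_alt (\<lambda>k. f k z) j + \<alpha> j) (at z)"
    "\<And>z. z \<notin> T \<Longrightarrow> (\<Sum>j<5. f j z) = z"
    using assms(1) unfolding A4_rational_solution_def cyc_alt_def by blast
  show "\<forall>j<5. Q * pderiv (p j) - p j * pderiv Q = p j * cyc_alt p j + smult (\<alpha> j) (Q * Q)"
  proof (intro allI impI poly_eqI_cofinite[of "S \<union> T"])
    fix j :: nat and z assume j: "j < 5" and z: "z \<notin> S \<union> T"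
    have Q: "poly Q z \<noteq> 0" and f: "f k z = poly (p k) z / poly Q z" if "k < 5" for k
      using S(2) z that by auto
    have "((\<lambda>w. poly (p j) w / poly Q w) has_field_derivative
        f j z * cyc_alt (\<lambda>k. f k z) j + \<alpha> j) (at z)"
    \<comment> \<open>\<open>f j\<close> agrees with the quotient only off the finite set
      \<open>S\<close>; its complement is open, which suffices to transfer the derivative.\<close>
    proof (rule has_field_derivative_transform_within_open)
      show "(f j has_field_derivative f j z * cyc_alt (\<lambda>k. f k z) j + \<alpha> j) (at z)"
        using T(2) j z by blast
      show "open (- S)" "z \<in> - S"
        using S(1) z by (simp_all add: finite_imp_closed open_Compl)
      show "f j w = poly (p j) w / poly Q w" if "w \<in> - S" for w
        using S(2) j that by blast
    qed
    moreover have "((\<lambda>w. poly (p j) w / poly Q w) has_field_derivative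
        (poly (pderiv (p j)) z * poly Q z - poly (p j) z * poly (pderiv Q) z) / (poly Q z * poly Q z)) (at z)"
      using Q[OF j] by (auto intro!: derivative_eq_intros)
    ultimately have "(poly (pderiv (p j)) z * poly Q z - poly (p j) z * poly (pderiv Q) z) / (poly Q z * poly Q z)
        = f j z * cyc_alt (\<lambda>k. f k z) j + \<alpha> j"
      by (rule DERIV_unique[symmetric])
    also have "cyc_alt (\<lambda>k. f k z) j = cyc_alt (\<lambda>k. poly (p k) z / poly Q z) j"
      by (simp add: cyc_alt_def f)
    finally show "poly (Q * pderiv (p j) - p j * pderiv Q) z = poly (p j * cyc_alt p j + smult (\<alpha> j) (Q * Q)) z"
      using Q[OF j] f[OF j] by (simp add: poly_cyc_alt cyc_alt_divide field_simps)
  qed (use S T in auto)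
  show "(\<Sum>j<5. p j) = [:0, 1:] * Q"
  proof (rule poly_eqI_cofinite[of "S \<union> T"])
    fix z assume z: "z \<notin> S \<union> T"
    have "z = (\<Sum>j<5. poly (p j) z / poly Q z)" using T(3)[of z] S(2)[of z] z by simp
    also have "\<dots> = (\<Sum>j<5. poly (p j) z) / poly Q z" by (simp add: sum_divide_distrib)
    finally show "poly (\<Sum>j<5. p j) z = poly ([:0, 1:] * Q) z"
      using S(2)[of z] z by (simp add: poly_sum field_simps)
  qed (use S T in auto)
qed

text \<open>At a root of \<open>Q\<close> every term with a factor \<open>Q\<close> disappears. If
  the derivative of \<open>Q\<close> vanished too, the nonzero vector of numerators would solve the
  homogeneous system. The quotients in the second claim are the residues at
  \<open>c\<close>.\<close>

lemma A4_denominator_simple_roots: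
  fixes Q :: "complex poly"
  assumes eqs: "\<forall>j<5. Q * pderiv (p j) - p j * pderiv Q = p j * cyc_alt p j + smult (\<alpha> j) (Q * Q)"
    and sum: "(\<Sum>j<5. p j) = [:0, 1:] * Q"
    and red: "\<exists>j<5. poly (p j) c \<noteq> 0"
    and root: "poly Q c = 0"
  shows "poly (pderiv Q) c \<noteq> 0"
    and "\<forall>j<5. poly (p j) c / poly (pderiv Q) c \<in> \<int>"
proof -
  have eq: "poly (p j) c * (cyc_alt (\<lambda>k. poly (p k) c) j + poly (pderiv Q) c) = 0" if "j < 5" for j
  proof -
    have "poly (Q * pderiv (p j) - p j * pderiv Q) c = poly (p j * cyc_alt p j + smult (\<alpha> j) (Q * Q)) c"
      using eqs that by simp
    then have "poly (p j) c * cyc_alt (\<lambda>k. poly (p k) c) j = - (poly (p j) c * poly (pderiv Q) c)"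
      unfolding poly_diff poly_mult poly_add poly_smult poly_cyc_alt root by simp
    then show ?thesis by (simp add: distrib_left)
  qed
  have s: "(\<Sum>j<5. poly (p j) c) = 0"
    using arg_cong[OF sum, of "\<lambda>q. poly q c"] root by (simp add: poly_sum)
  show nz: "poly (pderiv Q) c \<noteq> 0"
  proof
    assume "poly (pderiv Q) c = 0"
    then have "\<forall>j<5. poly (p j) c * cyc_alt (\<lambda>k. poly (p k) c) j = 0"
      using eq by (simp only: add_0_right) blast
    then show False
      using cyc_alt_homogeneous_zero[OF _ s] red by blast
  qed
  show "\<forall>j<5. poly (p j) c / poly (pderiv Q) c \<in> \<int>"
  proof (intro allI impI cyc_alt_residues_Ints[of "\<lambda>k. poly (p k) c / poly (pderiv Q) c"])
    show "(\<Sum>j<5. poly (p j) c / poly (pderiv Q) c) = 0"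
      using s by (simp flip: sum_divide_distrib)
    \<comment> \<open>This is \<open>eq\<close> divided by the square of the derivative of
      \<open>Q\<close> at \<open>c\<close>.\<close>
    fix j :: nat assume "j < 5"
    then show "poly (p j) c / poly (pderiv Q) c *
        (cyc_alt (\<lambda>k. poly (p k) c / poly (pderiv Q) c) j + 1) = 0"
      using eq[of j] nz by (auto simp: cyc_alt_divide field_simps)
  qed
qed

text \<open>If the largest numerator degree \<open>N\<close> were at least
  \<open>degree Q + 2\<close>, only the product \<open>p k * cyc_alt p k\<close> could contribute in
  degree \<open>N + N\<close>. The coefficients of degree \<open>N\<close> would then solve the
  homogeneous system and all vanish.\<close>

lemma A4_numerator_degree:
  fixes Q :: "complex poly"
  assumes eqs: "\<forall>j<5. Q * pderiv (p j) - p j * pderiv Q = p j * cyc_alt p j + smult (\<alpha> j) (Q * Q)"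
    and sum: "(\<Sum>j<5. p j) = [:0, 1:] * Q"
    and "j < 5"
  shows "degree (p j) \<le> degree Q + 1"
proof (rule ccontr)
  assume big: "\<not> ?thesis"
  define N where "N = Max ((\<lambda>j. degree (p j)) ` {..<5})"
  have le: "degree (p k) \<le> N" if "k < 5" for k
    unfolding N_def using that by (intro Max_ge) auto
  have "N \<in> (\<lambda>j. degree (p j)) ` {..<5}"
    unfolding N_def by (intro Max_in) (auto simp: lessThan_empty_iff)
  then obtain m where m: "m < 5" "degree (p m) = N" by auto
  have N: "N \<ge> degree Q + 2" using big le[OF \<open>j < 5\<close>] by simp
  have "coeff (p k) N * cyc_alt (\<lambda>k. coeff (p k) N) k = 0" if "k < 5" for k
  proof -
    have "degree (cyc_alt p k) \<le> N"
      unfolding cyc_alt_def by (intro degree_add_le degree_diff_le le) auto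
    then have "coeff (p k * cyc_alt p k) (N + N) = coeff (p k) N * cyc_alt (\<lambda>k. coeff (p k) N) k"
      using le[OF that] by (simp add: coeff_mult_add_le coeff_cyc_alt)
    moreover have "degree (Q * pderiv (p k)) < N + N" "degree (p k * pderiv Q) < N + N"
        "degree (Q * Q) < N + N"
      using degree_mult_le[of Q "pderiv (p k)"] degree_mult_le[of "p k" "pderiv Q"]
        degree_mult_le[of Q Q] le[OF that] N
        degree_pderiv[of Q] degree_pderiv[of "p k"]
      by linarith+
    moreover have "coeff (Q * pderiv (p k) - p k * pderiv Q) (N + N)
        = coeff (p k * cyc_alt p k + smult (\<alpha> k) (Q * Q)) (N + N)"
      using eqs that by simp
    ultimately show ?thesis by (simp add: coeff_eq_0)
  qed
  moreover have "(\<Sum>k<5. coeff (p k) N) = 0"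
  proof -
    have "degree ([:0, 1:] * Q) < N"
      using degree_mult_le[of "[:0, 1:]" Q] N by (simp del: mult_pCons_left)
    then show ?thesis
      using arg_cong[OF sum, of "\<lambda>q. coeff q N"]
      by (simp add: coeff_sum coeff_eq_0 del: mult_pCons_left)
  qed
  ultimately have "coeff (p m) N = 0"
    using cyc_alt_homogeneous_zero[of "\<lambda>k. coeff (p k) N"] m by blast
  with m N show False by force
qed

text \<open>Lagrange interpolation: \<open>R\<close> is determined by its values at the
  \<open>degree Q\<close> distinct roots of \<open>Q\<close>. The alternative \<open>R = 0\<close>
  is what remains when \<open>Q\<close> is constant.\<close>

lemma partial_fractions_simple_roots:
  fixes Q R :: "complex poly"
  assumes simple: "\<And>c. poly Q c = 0 \<Longrightarrow> poly (pderiv Q) c \<noteq> 0"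
    and deg: "R = 0 \<or> degree R < degree Q" and z: "poly Q z \<noteq> 0"
  shows "poly R z / poly Q z = (\<Sum>c | poly Q c = 0. poly R c / poly (pderiv Q) c / (z - c))"
proof -
  define C where "C = {c. poly Q c = 0}"
  have "Q \<noteq> 0" using z by auto
  then have fin: "finite C" by (simp add: C_def poly_roots_finite)
  have Q: "Q = smult (lead_coeff Q) (\<Prod>c\<in>C. [:-c, 1:])"
    unfolding C_def using simple by (subst complex_poly_decompose_rsquarefree) (auto simp: rsquarefree_roots)
  have "degree Q = (\<Sum>c\<in>C. degree [:-c, 1:])"
    using \<open>Q \<noteq> 0\<close> by (subst Q) (simp add: degree_prod_eq_sum_degree)
  then have card: "card C = degree Q" by simp
  \<comment> \<open>\<open>B c\<close> is the cofactor of the linear factor at \<open>c\<close>. It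
    vanishes at all other roots, and at \<open>c\<close> it equals the derivative of
    \<open>Q\<close>.\<close>
  define B where "B = (\<lambda>c. smult (lead_coeff Q) (\<Prod>d\<in>C - {c}. [:-d, 1:]))"
  have QB: "Q = [:-c, 1:] * B c" if "c \<in> C" for c
    by (subst Q) (simp add: B_def prod.remove[OF fin that] del: mult_pCons_left)
  have B_eq: "poly (B c) c = poly (pderiv Q) c" if "c \<in> C" for c
    by (subst QB[OF that], subst pderiv_mult) (simp add: pderiv_pCons)
  have B_neq: "poly (B c) d = 0" if "c \<in> C" "d \<in> C" "d \<noteq> c" for c d
  proof -
    have "poly Q d = (d - c) * poly (B c) d"
      by (subst QB[OF that(1)], subst poly_mult) simp
    then show ?thesis using that by (simp add: C_def)
  qed
  \<comment> \<open>The interpolant of \<open>R\<close> at the roots of \<open>Q\<close>.\<close>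
  define P where "P = (\<Sum>c\<in>C. smult (poly R c / poly (pderiv Q) c) (B c))"
  have "R = P"
  proof (cases "C = {}")
    case True
    then show ?thesis using deg card by (simp add: P_def)
  next
    case False
    then have pos: "degree Q > 0" using card fin by (metis card_gt_0_iff)
    have "degree (B c) < degree Q" if "c \<in> C" for c
    proof -
      have "B c \<noteq> 0" using QB[OF that] \<open>Q \<noteq> 0\<close> by auto
      then have "degree Q = degree [:-c, 1:] + degree (B c)"
        by (subst QB[OF that], subst degree_mult_eq) auto
      then show ?thesis by simp
    qed
    then have "degree P < degree Q"
      unfolding P_def using pos by (intro degree_sum_less) (auto intro: le_less_trans[OF degree_smult_le])
    moreover have "degree R < degree Q" using deg pos by auto
    moreover have "poly R d = poly P d" if "d \<in> C" for d
    proof -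
      have "poly P d = (\<Sum>c\<in>C. if c = d then poly R d else 0)"
        unfolding P_def poly_sum
        using B_eq B_neq simple that by (intro sum.cong) (auto simp: C_def)
      then show ?thesis using fin that by simp
    qed
    ultimately show ?thesis using poly_eqI_degree[of C R P] card by simp
  qed
  have "poly R z / poly Q z = (\<Sum>c\<in>C. poly R c / poly (pderiv Q) c * (poly (B c) z / poly Q z))"
    by (subst \<open>R = P\<close>) (simp add: P_def poly_sum sum_divide_distrib)
  also have "\<dots> = (\<Sum>c\<in>C. poly R c / poly (pderiv Q) c / (z - c))"
  proof (rule sum.cong)
    fix c assume c: "c \<in> C"
    have "poly Q z = (z - c) * poly (B c) z"
      by (subst QB[OF c], subst poly_mult) simp
    then show "poly R c / poly (pderiv Q) c * (poly (B c) z / poly Q z)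
        = poly R c / poly (pderiv Q) c / (z - c)"
      using z by simp
  qed simp
  finally show ?thesis by (simp add: C_def)
qed

text \<open>Division by the reduced denominator splits off a polynomial part, linear by the degree
  bound. The remainder decomposes into simple fractions whose numerators are the integer
  residues.\<close>

lemma A4_partial_fractions:
  assumes "A4_rational_solution \<alpha> f"
  obtains C S a b r where "finite C" "finite S" "C \<subseteq> S" "\<And>j c. j < 5 \<Longrightarrow> c \<in> C \<Longrightarrow> r j c \<in> \<int>"
    "\<And>j z. j < 5 \<Longrightarrow> z \<notin> S \<Longrightarrow> f j z = a j * z + b j + (\<Sum>c\<in>C. r j c / (z - c))"
proof -
  have "\<forall>j<5. rat_fun (f j)" using assms by (simp add: A4_rational_solution_def)
  then obtain Q p where Qp: "common_denominator f Q p"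
    and red: "\<And>c. poly Q c = 0 \<Longrightarrow> \<exists>j<5. poly (p j) c \<noteq> 0"
    using reduced_denominator_exists by blast
  note eqs = A4_polynomial_system[OF assms Qp]
  note roots = A4_denominator_simple_roots[OF eqs red]
  obtain S where S: "Q \<noteq> 0" "finite S"
    "\<And>z. z \<notin> S \<Longrightarrow> poly Q z \<noteq> 0 \<and> (\<forall>j<5. f j z = poly (p j) z / poly Q z)"
    using Qp unfolding common_denominator_def by blast
  define C where "C = {c. poly Q c = 0}"
  define D where "D = (\<lambda>j. p j div Q)"
  define M where "M = (\<lambda>j. p j mod Q)"
  have pDM: "p j = D j * Q + M j" for j by (simp add: D_def M_def)
  have M: "M j = 0 \<or> degree (M j) < degree Q" for j
    using S(1) by (simp add: M_def degree_mod_less)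
  have D: "poly (D j) z = coeff (D j) 1 * z + coeff (D j) 0" if "j < 5" for j z
  proof -
    have "degree (D j) \<le> 1"
    proof (cases "D j = 0")
      case False
      have "degree (D j) + degree Q = degree (p j - M j)"
        using False S(1) pDM[of j] by (simp add: degree_mult_eq)
      also have "\<dots> \<le> degree Q + 1"
        using A4_numerator_degree[OF eqs that] M[of j] by (intro degree_diff_le) auto
      finally show ?thesis by simp
    qed simp
    then have "D j = [:coeff (D j) 0, coeff (D j) 1:]"
      by (intro poly_eqI) (auto simp: coeff_pCons coeff_eq_0 split: nat.split)
    then have "poly (D j) z = poly [:coeff (D j) 0, coeff (D j) 1:] z" by simp
    then show ?thesis by simp
  qed
  have f: "f j z = coeff (D j) 1 * z + coeff (D j) 0 + (\<Sum>c\<in>C. poly (p j) c / poly (pderiv Q) c / (z - c))"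
    if "j < 5" "z \<notin> S" for j z
  proof -
    have Qz: "poly Q z \<noteq> 0" using S(3) that by blast
    have "f j z = poly (D j * Q + M j) z / poly Q z" using S(3) that pDM[of j] by metis
    also have "\<dots> = poly (D j) z + poly (M j) z / poly Q z"
      using Qz by (simp add: add_divide_distrib)
    also have "poly (M j) z / poly Q z = (\<Sum>c\<in>C. poly (M j) c / poly (pderiv Q) c / (z - c))"
      unfolding C_def using roots(1) M Qz by (rule partial_fractions_simple_roots)
    \<comment> \<open>The remainder and \<open>p j\<close> agree at the roots of \<open>Q\<close>,
      so they have the same residues.\<close>
    also have "\<dots> = (\<Sum>c\<in>C. poly (p j) c / poly (pderiv Q) c / (z - c))"
      by (intro sum.cong) (auto simp: C_def pDM[of j])
    finally show ?thesis using D that by simp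
  qed
  have CS: "C \<subseteq> S" using S(3) by (auto simp: C_def)
  show ?thesis
  proof (rule that)
    show "finite C" using CS S(2) by (rule finite_subset)
    show "poly (p j) c / poly (pderiv Q) c \<in> \<int>" if "j < 5" "c \<in> C" for j c
      using roots(2) that by (simp add: C_def)
  qed (rule S(2) CS f; assumption)+
qed

subsection \<open>The expansion at infinity\<close>

lemma eventually_not_in_finite_at_infinity:
  fixes S :: "complex set"
  assumes "finite S"
  shows "\<forall>\<^sub>F z in at_infinity. z \<notin> S"
proof -
  obtain B where "\<And>z. z \<in> S \<Longrightarrow> norm z \<le> B"
    using finite_imp_bounded[OF assms] unfolding bounded_iff by blast
  then show ?thesis
    unfolding eventually_at_infinity by (intro exI[of _ "B + 1"]) force
qed

lemma tendsto_inverse_shift_at_infinity: "((\<lambda>z. k / (z - c)) \<longlongrightarrow> 0) at_infinity" for c k :: complex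
proof -
  have "filterlim (\<lambda>z. - c + z) at_infinity at_infinity"
    by (intro tendsto_add_filterlim_at_infinity[OF tendsto_const] filterlim_ident)
  then have "((\<lambda>z. k / (- c + z)) \<longlongrightarrow> 0) at_infinity"
    by (intro tendsto_divide_0[OF tendsto_const])
  then show ?thesis by simp
qed

text \<open>These limits control the fractional part of a solution, its coefficient of
  \<open>1 / z\<close> at infinity, and, up to sign, its derivative.\<close>

lemma simple_fractions_tendsto:
  fixes r :: "complex \<Rightarrow> complex"
  assumes "finite C"
  shows "((\<lambda>z. \<Sum>c\<in>C. r c / (z - c)) \<longlongrightarrow> 0) at_infinity"
    and "((\<lambda>z. z * (\<Sum>c\<in>C. r c / (z - c))) \<longlongrightarrow> (\<Sum>c\<in>C. r c)) at_infinity"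
    and "((\<lambda>z. \<Sum>c\<in>C. r c / (z - c) ^ 2) \<longlongrightarrow> 0) at_infinity"
proof -
  show "((\<lambda>z. \<Sum>c\<in>C. r c / (z - c)) \<longlongrightarrow> 0) at_infinity"
    by (intro tendsto_null_sum tendsto_inverse_shift_at_infinity)
  have "((\<lambda>z. r c / (z - c) * (1 / (z - c))) \<longlongrightarrow> 0 * 0) at_infinity" for c
    by (intro tendsto_mult tendsto_inverse_shift_at_infinity)
  then show "((\<lambda>z. \<Sum>c\<in>C. r c / (z - c) ^ 2) \<longlongrightarrow> 0) at_infinity"
    by (intro tendsto_null_sum) (simp add: power2_eq_square)
  \<comment> \<open>Uses \<open>z * (r c / (z - c)) = r c + r c * c / (z - c)\<close>.\<close>
  have "((\<lambda>z. \<Sum>c\<in>C. r c + (r c * c) / (z - c)) \<longlongrightarrow> (\<Sum>c\<in>C. r c + 0)) at_infinity"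
    by (intro tendsto_sum tendsto_add tendsto_const tendsto_inverse_shift_at_infinity)
  then have lim: "((\<lambda>z. \<Sum>c\<in>C. r c + (r c * c) / (z - c)) \<longlongrightarrow> (\<Sum>c\<in>C. r c)) at_infinity"
    by simp
  show "((\<lambda>z. z * (\<Sum>c\<in>C. r c / (z - c))) \<longlongrightarrow> (\<Sum>c\<in>C. r c)) at_infinity"
  proof (rule Lim_transform_eventually[OF lim])
    show "\<forall>\<^sub>F z in at_infinity. (\<Sum>c\<in>C. r c + r c * c / (z - c)) = z * (\<Sum>c\<in>C. r c / (z - c))"
      using eventually_not_in_finite_at_infinity[OF assms]
    proof eventually_elim
      case (elim z)
      then have "r c + r c * c / (z - c) = z * (r c / (z - c))" if "c \<in> C" for c
        using that by (subst add_divide_eq_iff) (auto simp: algebra_simps)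
      then show ?case by (simp add: sum_distrib_left)
    qed
  qed
qed

text \<open>Converts a limit at infinity into equations between coefficients, which is how the
  relations of the expansion are read off.\<close>

lemma poly_tendsto_at_infinityD:
  fixes p :: "complex poly"
  assumes "((\<lambda>z. poly p z) \<longlongrightarrow> l) at_infinity"
  shows "p = [:l:]"
proof -
  have "degree p = 0"
  proof (rule ccontr)
    assume "degree p \<noteq> 0"
    then have "filterlim (poly p) at_infinity at_infinity"
      by (intro filterlim_poly_at_infinity) auto
    then show False
      using not_tendsto_and_filterlim_at_infinity[OF trivial_limit_at_infinity assms] by simp
  qed
  then obtain k where k: "p = [:k:]" by (rule degree_eq_zeroE)
  then show ?thesis
    using tendsto_unique[OF trivial_limit_at_infinity assms, of k] by (simp add: tendsto_const)
qed

text \<open>The relations satisfied by the coefficients of \<open>f j z = a j * z + b j + c j / z + \<dots>\<close> at infinity.\<close>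
definition A4_expansion ::
    "(nat \<Rightarrow> complex) \<Rightarrow> (nat \<Rightarrow> complex) \<Rightarrow> (nat \<Rightarrow> complex) \<Rightarrow> (nat \<Rightarrow> complex) \<Rightarrow> bool" where
  "A4_expansion \<alpha> a b c \<longleftrightarrow>
     (\<forall>j<5. a j * cyc_alt a j = 0 \<and> a j * cyc_alt b j + b j * cyc_alt a j = 0 \<and>
        \<alpha> j = a j - b j * cyc_alt b j - a j * cyc_alt c j - c j * cyc_alt a j \<and> c j \<in> \<int>) \<and>
     (\<Sum>j<5. a j) = 1 \<and> (\<Sum>j<5. b j) = 0 \<and> (\<Sum>j<5. c j) = 0"

text \<open>The partial fractions are substituted into the system. What remains besides a polynomial
  of degree at most two has a finite limit at infinity, so that polynomial is constant and equal to
  the limit.\<close>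

lemma A4_expansion_exists:
  assumes "A4_rational_solution \<alpha> f"
  shows "\<exists>a b c. A4_expansion \<alpha> a b c \<and> (\<forall>j<5. pole_inf (f j) \<longleftrightarrow> a j \<noteq> 0)"
proof (rule A4_partial_fractions[OF assms])
  fix C S :: "complex set" and a b :: "nat \<Rightarrow> complex" and r :: "nat \<Rightarrow> complex \<Rightarrow> complex"
  assume fin: "finite C" "finite S" and CS: "C \<subseteq> S"
    and r: "\<And>j c. j < 5 \<Longrightarrow> c \<in> C \<Longrightarrow> r j c \<in> \<int>"
    and f: "\<And>j z. j < 5 \<Longrightarrow> z \<notin> S \<Longrightarrow> f j z = a j * z + b j + (\<Sum>c\<in>C. r j c / (z - c))"
  obtain T where T: "finite T"
    "\<And>z j. z \<notin> T \<Longrightarrow> j < 5 \<Longrightarrow> (f j has_field_derivative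
        f j z * cyc_alt (\<lambda>k. f k z) j + \<alpha> j) (at z)"
    "\<And>z. z \<notin> T \<Longrightarrow> (\<Sum>j<5. f j z) = z"
    using assms unfolding A4_rational_solution_def cyc_alt_def by blast
  define G where "G = (\<lambda>j z. \<Sum>c\<in>C. r j c / (z - c))"
  define H where "H = (\<lambda>j z. \<Sum>c\<in>C. r j c / (z - c) ^ 2)"
  define c where "c = (\<lambda>j. \<Sum>d\<in>C. r j d)"
  have G0: "(G j \<longlongrightarrow> 0) at_infinity" and zG: "((\<lambda>z. z * G j z) \<longlongrightarrow> c j) at_infinity"
    and H0: "(H j \<longlongrightarrow> 0) at_infinity" for j
    unfolding G_def H_def c_def by (intro simple_fractions_tendsto fin)+
  have away: "\<forall>\<^sub>F z in at_infinity. z \<notin> S \<union> T"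
    using fin T(1) by (intro eventually_not_in_finite_at_infinity) simp
  have cyc0: "((\<lambda>z. cyc_alt (\<lambda>k. G k z) j) \<longlongrightarrow> 0) at_infinity" for j
    unfolding cyc_alt_def using tendsto_diff[OF tendsto_add[OF tendsto_diff[OF G0 G0] G0] G0] by simp
  have zcyc: "((\<lambda>z. z * cyc_alt (\<lambda>k. G k z) j) \<longlongrightarrow> cyc_alt c j) at_infinity" for j
    unfolding cyc_alt_def ring_distribs by (intro tendsto_intros zG)
  have "a j * cyc_alt a j = 0 \<and> a j * cyc_alt b j + b j * cyc_alt a j = 0 \<and>
      \<alpha> j = a j - b j * cyc_alt b j - a j * cyc_alt c j - c j * cyc_alt a j" if j: "j < 5" for j
  proof -
    let ?A = "cyc_alt a j" and ?B = "cyc_alt b j"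
    have deriv: "a j - H j z = (a j * z + b j + G j z) * (?A * z + ?B + cyc_alt (\<lambda>k. G k z) j) + \<alpha> j"
      if z: "z \<notin> S \<union> T" for z
    proof -
      have "((\<lambda>w. a j * w + b j + G j w) has_field_derivative
          f j z * cyc_alt (\<lambda>k. f k z) j + \<alpha> j) (at z)"
      proof (rule has_field_derivative_transform_within_open)
        show "(f j has_field_derivative f j z * cyc_alt (\<lambda>k. f k z) j + \<alpha> j) (at z)"
          using T(2) j z by blast
        show "open (- S)" "z \<in> - S"
          using fin(2) z by (simp_all add: finite_imp_closed open_Compl)
        show "f j w = a j * w + b j + G j w" if "w \<in> - S" for w
          using f j that by (simp add: G_def)
      qed
      moreover have "((\<lambda>w. a j * w + b j + G j w) has_field_derivative
          a j + (\<Sum>d\<in>C. - (r j d / (z - d) ^ 2))) (at z)"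
      proof -
        have "((\<lambda>w. r j d / (w - d)) has_field_derivative - (r j d / (z - d) ^ 2)) (at z)" if "d \<in> C" for d
          using that z CS by (auto intro!: derivative_eq_intros simp: power2_eq_square)
        then have "((\<lambda>w. G j w) has_field_derivative (\<Sum>d\<in>C. - (r j d / (z - d) ^ 2))) (at z)"
          unfolding G_def by (intro DERIV_sum)
        then show ?thesis by (auto intro!: derivative_eq_intros)
      qed
      ultimately have "a j + (\<Sum>d\<in>C. - (r j d / (z - d) ^ 2)) = f j z * cyc_alt (\<lambda>k. f k z) j + \<alpha> j"
        by (rule DERIV_unique[symmetric])
      moreover have "cyc_alt (\<lambda>k. f k z) j = cyc_alt (\<lambda>k. a k * z + b k + G k z) j"
        using z by (simp add: cyc_alt_def f G_def)
      moreover have "\<dots> = ?A * z + ?B + cyc_alt (\<lambda>k. G k z) j"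
        by (simp add: cyc_alt_def algebra_simps)
      moreover have "f j z = a j * z + b j + G j z" using z j by (simp add: f G_def)
      ultimately show ?thesis by (simp add: H_def sum_negf)
    qed
    \<comment> \<open>\<open>P\<close> collects the pure powers of \<open>z\<close> in
      \<open>deriv\<close>. \<open>?rem\<close> regroups all other terms so that \<open>z\<close>
      occurs only in products having a limit.\<close>
    define P where "P = [:\<alpha> j - a j + b j * ?B, a j * ?B + b j * ?A, a j * ?A:]"
    let ?rem = "\<lambda>z. - H j z - (?A * (z * G j z) + ?B * G j z) - (a j * (z * cyc_alt (\<lambda>k. G k z) j)
        + b j * cyc_alt (\<lambda>k. G k z) j) - G j z * cyc_alt (\<lambda>k. G k z) j"
    have "(?rem \<longlongrightarrow> - 0 - (?A * c j + ?B * 0) - (a j * cyc_alt c j + b j * 0) - 0 * 0) at_infinity"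
      by (intro tendsto_intros H0 G0 zG cyc0 zcyc)
    then have "((\<lambda>z. poly P z) \<longlongrightarrow> - (?A * c j) - a j * cyc_alt c j) at_infinity"
    proof (rule Lim_transform_eventually[THEN tendsto_eq_rhs])
      show "\<forall>\<^sub>F z in at_infinity. ?rem z = poly P z"
        using away
      proof eventually_elim
        case (elim z)
        from deriv[OF this] show ?case
          unfolding P_def by (simp add: algebra_simps)
      qed
    qed simp
    then have "P = [:- (?A * c j) - a j * cyc_alt c j:]"
      by (rule poly_tendsto_at_infinityD)
    then show ?thesis
      by (auto simp: P_def algebra_simps)
  qed
  moreover have "c j \<in> \<int>" if "j < 5" for j
    using r that by (simp add: c_def Ints_sum)
  moreover have "(\<Sum>j<5. a j) = 1 \<and> (\<Sum>j<5. b j) = 0 \<and> (\<Sum>j<5. c j) = 0"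
  proof -
    have sumG: "z - (\<Sum>j<5. a j) * z - (\<Sum>j<5. b j) = (\<Sum>j<5. G j z)" if "z \<notin> S \<union> T" for z
    proof -
      have "z = (\<Sum>j<5. a j * z + b j + G j z)"
        using T(3)[of z] that by (simp add: f G_def)
      also have "\<dots> = (\<Sum>j<5. a j) * z + (\<Sum>j<5. b j) + (\<Sum>j<5. G j z)"
        by (simp add: sum.distrib sum_distrib_right)
      finally show ?thesis by algebra
    qed
    define P where "P = [:- (\<Sum>j<5. b j), 1 - (\<Sum>j<5. a j):]"
    have "((\<lambda>z. \<Sum>j<5. G j z) \<longlongrightarrow> 0) at_infinity"
      by (intro tendsto_null_sum G0)
    moreover have "\<forall>\<^sub>F z in at_infinity. (\<Sum>j<5. G j z) = poly P z"
      using away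
    proof eventually_elim
      case (elim z)
      from sumG[OF this] show ?case by (simp add: P_def algebra_simps)
    qed
    ultimately have "((\<lambda>z. poly P z) \<longlongrightarrow> 0) at_infinity"
      by (rule Lim_transform_eventually)
    then have "P = [:0:]" by (rule poly_tendsto_at_infinityD)
    then have ab: "(\<Sum>j<5. a j) = 1" "(\<Sum>j<5. b j) = 0" by (simp_all add: P_def)
    \<comment> \<open>With \<open>ab\<close> known, \<open>sumG\<close> says that the fractional
      parts cancel far out; multiplying by \<open>z\<close> yields the sum of the
      \<open>c j\<close>.\<close>
    have "((\<lambda>z. \<Sum>j<5. z * G j z) \<longlongrightarrow> (\<Sum>j<5. c j)) at_infinity"
      by (intro tendsto_sum zG)
    moreover have "\<forall>\<^sub>F z in at_infinity. (\<Sum>j<5. z * G j z) = 0"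
      using away
    proof eventually_elim
      case (elim z)
      from sumG[OF this] ab show ?case by (simp flip: sum_distrib_left)
    qed
    ultimately have "((\<lambda>z::complex. 0) \<longlongrightarrow> (\<Sum>j<5. c j)) at_infinity"
      by (rule Lim_transform_eventually)
    then have "(\<Sum>j<5. c j) = 0"
      using tendsto_unique[OF trivial_limit_at_infinity _ tendsto_const] by blast
    with ab show ?thesis by simp
  qed
  moreover have "pole_inf (f j) \<longleftrightarrow> a j \<noteq> 0" if j: "j < 5" for j
  proof -
    \<comment> \<open>Everything except the linear term stays bounded, so \<open>a j\<close> alone
      decides whether there is a pole.\<close>
    have bG: "((\<lambda>z. b j + G j z) \<longlongrightarrow> b j + 0) at_infinity"
      by (intro tendsto_intros G0)
    have ev: "\<forall>\<^sub>F z in at_infinity. f j z = (b j + G j z) + a j * z"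
      using away by eventually_elim (simp add: f[OF j] G_def algebra_simps)
    show ?thesis
    proof (cases "a j = 0")
      case True
      have "(f j \<longlongrightarrow> b j + 0) at_infinity"
        using bG by (rule Lim_transform_eventually) (use ev True in \<open>auto elim: eventually_mono\<close>)
      then show ?thesis
        using True not_tendsto_and_filterlim_at_infinity[OF trivial_limit_at_infinity]
        unfolding pole_inf_def by blast
    next
      case False
      then have "filterlim (\<lambda>z. a j * z) at_infinity at_infinity"
        by (intro tendsto_mult_filterlim_at_infinity[OF tendsto_const] filterlim_ident)
      then have "filterlim (\<lambda>z. (b j + G j z) + a j * z) at_infinity at_infinity"
        by (rule tendsto_add_filterlim_at_infinity[OF bG])
      then have "filterlim (f j) at_infinity at_infinity"
        using filterlim_cong[OF refl refl ev] by simp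
      then show ?thesis using False by (simp add: pole_inf_def)
    qed
  qed
  ultimately show ?thesis
    unfolding A4_expansion_def by blast
qed

section \<open>Cyclic symmetry and elimination of the constant terms\<close>

lemma cyc_alt_rotate: "cyc_alt (\<lambda>k. v ((i + k) mod 5)) j = cyc_alt v ((i + j) mod 5)"
  by (simp add: cyc_alt_def mod_simps add.assoc)

lemma sum_rotate_5: "(\<Sum>k<5. v ((i + k) mod 5)) = (\<Sum>k<5. v k)" if "i < 5"
  for v :: "nat \<Rightarrow> 'a::comm_monoid_add"
  using that unfolding less_5_iff sum_less_5
  by (elim disjE) (simp_all add: ac_simps numeral_2_eq_2)

text \<open>Reduces a type with index \<open>i\<close> to the same type with index 0.\<close>

lemma A4_expansion_rotate:
  assumes "A4_expansion \<alpha> a b c" and "i < 5"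
  shows "A4_expansion (\<lambda>k. \<alpha> ((i + k) mod 5)) (\<lambda>k. a ((i + k) mod 5))
    (\<lambda>k. b ((i + k) mod 5)) (\<lambda>k. c ((i + k) mod 5))"
  using assms unfolding A4_expansion_def cyc_alt_rotate sum_rotate_5[OF assms(2)] by auto

lemma cyc_alt_Ints: "\<forall>j<5. v j \<in> \<int> \<Longrightarrow> cyc_alt v j \<in> \<int>"
  for v :: "nat \<Rightarrow> complex"
  by (simp add: cyc_alt_def)

text \<open>The coefficients \<open>b\<close> drop out. Where \<open>a k = 0\<close>, the second
  relation and \<open>nz\<close> force \<open>b k = 0\<close>; where \<open>a k\<close> is nonzero,
  the first two relations force \<open>cyc_alt b k = 0\<close>.\<close>

lemma A4_expansion_parameters:
  assumes "A4_expansion \<alpha> a b c" and nz: "\<forall>j<5. a j = 0 \<longrightarrow> cyc_alt a j \<noteq> 0" and j: "j < 5"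
  shows "\<alpha> j = a j - a j * cyc_alt c j - c j * cyc_alt a j"
proof -
  have eqs: "a k * cyc_alt a k = 0" "a k * cyc_alt b k + b k * cyc_alt a k = 0" if "k < 5" for k
    using assms(1) that by (auto simp: A4_expansion_def)
  have "b k * cyc_alt b k = 0" if "k < 5" for k
    using eqs[OF that] nz that by (cases "a k = 0") auto
  then have "b j * cyc_alt b j = 0" using j by blast
  then show ?thesis using assms(1) j by (simp add: A4_expansion_def)
qed

subsection \<open>Parameters of the three types\<close>

text \<open>Reduces the congruences to divisibility of integers, which \<open>presburger\<close> can
  decide.\<close>

lemma cong_Z_of_int_divide:
  assumes "m dvd x - y" "m \<noteq> 0"
  shows "cong_Z (of_int x / of_int m) (of_int y / of_int m)"
proof -
  obtain k where "x - y = m * k" using assms by (auto simp: dvd_def)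
  then have "(of_int x - of_int y :: complex) = of_int m * of_int k"
    by (metis of_int_diff of_int_mult)
  then have "(of_int x / of_int m - of_int y / of_int m :: complex) = of_int k"
    using assms(2) by (simp flip: diff_divide_distrib)
  then show ?thesis by (simp add: cong_Z_def)
qed

lemma A4_expansion_first_equations:
  assumes "A4_expansion \<alpha> a b c"
  shows "a 0 = 0 \<or> a 1 - a 2 + a 3 - a 4 = 0" "a 1 = 0 \<or> a 2 - a 3 + a 4 - a 0 = 0"
    "a 2 = 0 \<or> a 3 - a 4 + a 0 - a 1 = 0" "a 3 = 0 \<or> a 4 - a 0 + a 1 - a 2 = 0"
    "a 4 = 0 \<or> a 0 - a 1 + a 2 - a 3 = 0" "a 0 + a 1 + a 2 + a 3 + a 4 = 1"
  using assms unfolding A4_expansion_def all_less_5 cyc_alt_simps sum_less_5 mult_eq_0_iff by blast+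

lemma A4_expansion_integer_residues:
  assumes "A4_expansion \<alpha> a b c"
  obtains m where "\<And>j. j < 5 \<Longrightarrow> c j = of_int (m j)" "m 0 + m 1 + m 2 + m 3 + m 4 = 0"
proof -
  have "\<forall>j. \<exists>m. j < 5 \<longrightarrow> c j = of_int m"
    using assms unfolding A4_expansion_def by (metis Ints_cases)
  then obtain m where m: "\<And>j. j < 5 \<Longrightarrow> c j = of_int (m j)" by metis
  have "(of_int (\<Sum>j<5. m j) :: complex) = (\<Sum>j<5. c j)"
    using m by simp
  also have "\<dots> = 0" using assms by (simp add: A4_expansion_def)
  finally have "(\<Sum>j<5. m j) = 0" by (simp only: of_int_eq_0_iff)
  with m show ?thesis using that by (simp only: sum_less_5)
qed

text \<open>Serves both kinds of Type A, where the \<open>a k\<close> turn out to be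
  integers.\<close>

lemma A4_expansion_Ints:
  assumes "A4_expansion \<alpha> a b c" and int: "\<forall>k<5. a k \<in> \<int>"
    and nz: "\<forall>k<5. a k = 0 \<longrightarrow> cyc_alt a k \<noteq> 0" and "j < 5"
  shows "\<alpha> j \<in> \<int>"
proof -
  have "\<forall>k<5. c k \<in> \<int>" using assms(1) by (simp add: A4_expansion_def)
  then show ?thesis
    using A4_expansion_parameters[OF assms(1) nz \<open>j < 5\<close>] int \<open>j < 5\<close> by (simp add: cyc_alt_Ints)
qed

lemma A4_expansion_typeA1:
  assumes "A4_expansion \<alpha> a b c" and "a 1 = 0" "a 2 = 0" "a 3 = 0" "a 4 = 0" and "j < 5"
  shows "\<alpha> j \<in> \<int>"
proof -
  have a: "a 0 = 1" using A4_expansion_first_equations(6)[OF assms(1)] assms by simp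
  have int: "\<forall>k<5. a k \<in> \<int>" and nz: "\<forall>k<5. a k = 0 \<longrightarrow> cyc_alt a k \<noteq> 0"
    unfolding all_less_5 cyc_alt_simps using a assms(2-5) by simp_all
  from assms(1) int nz \<open>j < 5\<close> show ?thesis by (rule A4_expansion_Ints)
qed

lemma A4_expansion_typeA2:
  assumes "A4_expansion \<alpha> a b c" and "a 0 \<noteq> 0" "a 1 \<noteq> 0" "a 2 = 0" "a 3 \<noteq> 0" "a 4 = 0" and "j < 5"
  shows "\<alpha> j \<in> \<int>"
proof -
  note eqs = A4_expansion_first_equations[OF assms(1)]
  have "a 3 = - a 1" using eqs(1) assms(2-6) by (simp add: add_eq_0_iff)
  moreover from this have "a 1 = a 0" using eqs(2) assms(2-6) by simp
  ultimately have a: "a 0 = 1" "a 1 = 1" "a 3 = - 1"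
    using eqs(6) assms(4,6) by simp_all
  have int: "\<forall>k<5. a k \<in> \<int>" and nz: "\<forall>k<5. a k = 0 \<longrightarrow> cyc_alt a k \<noteq> 0"
    unfolding all_less_5 cyc_alt_simps using a assms(4,6) by simp_all
  from assms(1) int nz \<open>j < 5\<close> show ?thesis by (rule A4_expansion_Ints)
qed

lemma A4_expansion_typeB:
  assumes "A4_expansion \<alpha> a b c" and "a 0 \<noteq> 0" "a 1 \<noteq> 0" "a 2 \<noteq> 0" "a 3 = 0" "a 4 = 0"
  shows "\<exists>n1\<in>{0,1,2::int}. \<exists>n3\<in>{0,1,2::int}. \<exists>n4\<in>{0,1,2::int}.
           cong_Z (\<alpha> 0) (of_int n1 / 3 - of_int n3 / 3)
         \<and> cong_Z (\<alpha> 1) (of_int n1 / 3)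
         \<and> cong_Z (\<alpha> 2) (of_int n1 / 3 + of_int n4 / 3)
         \<and> cong_Z (\<alpha> 3) (of_int n3 / 3)
         \<and> cong_Z (\<alpha> 4) (- of_int n4 / 3)"
proof -
  note eqs = A4_expansion_first_equations[OF assms(1)]
  have "a 2 = a 1" "a 2 = a 0" using eqs(1,2) assms(2-6) by simp_all
  then have a: "a 0 = 1/3" "a 1 = 1/3" "a 2 = 1/3"
    using eqs(6) assms(5,6) by (simp_all add: eq_divide_eq mult.commute)
  have nz: "\<forall>k<5. a k = 0 \<longrightarrow> cyc_alt a k \<noteq> 0"
    unfolding all_less_5 cyc_alt_simps a assms(5,6) by simp
  note par = A4_expansion_parameters[OF assms(1) nz]
  obtain m where c: "\<And>j. j < 5 \<Longrightarrow> c j = of_int (m j)" and m: "m 0 + m 1 + m 2 + m 3 + m 4 = 0"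
    using A4_expansion_integer_residues[OF assms(1)] by metis
  have cs: "c 0 = of_int (m 0)" "c 1 = of_int (m 1)" "c 2 = of_int (m 2)" "c 3 = of_int (m 3)"
    "c 4 = of_int (m 4)" by (rule c, simp)+
  \<comment> \<open>\<open>N\<close> is three times \<alpha>(1).\<close>
  define N where "N = 1 - (m 2 - m 3 + m 4 - m 0)"
  have \<alpha>: "\<alpha> 0 = of_int (1 - (m 1 - m 2 + m 3 - m 4)) / of_int 3" "\<alpha> 1 = of_int N / of_int 3"
    "\<alpha> 2 = of_int (1 - (m 3 - m 4 + m 0 - m 1)) / of_int 3"
    "\<alpha> 3 = of_int (m 3) / of_int 3" "\<alpha> 4 = of_int (- m 4) / of_int 3"
    unfolding N_def
    by (subst par, simp, simp only: cyc_alt_simps a assms(5,6) cs, simp add: field_simps)+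
  \<comment> \<open>The three numbers are read off from \<alpha>(1), \<alpha>(3) and \<alpha>(4).
    The congruences for \<alpha>(0) and \<alpha>(2) then follow after \<open>m 0\<close> is
    eliminated by the vanishing sum.\<close>
  define n1 where "n1 = N mod 3"
  define n3 where "n3 = m 3 mod 3"
  define n4 where "n4 = m 4 mod 3"
  have m0: "m 0 = - m 1 - m 2 - m 3 - m 4" using m by simp
  have "n1 = N - 3 * (N div 3)" "n3 = m 3 - 3 * (m 3 div 3)" "n4 = m 4 - 3 * (m 4 div 3)"
    by (simp_all add: n1_def n3_def n4_def minus_mult_div_eq_mod)
  then have dvd: "3 dvd (1 - (m 1 - m 2 + m 3 - m 4)) - (n1 - n3)" "3 dvd N - n1"
    "3 dvd (1 - (m 3 - m 4 + m 0 - m 1)) - (n1 + n4)" "3 dvd m 3 - n3" "3 dvd - m 4 - (- n4)"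
    unfolding N_def m0 by presburger+
  have "n1 \<in> {0,1,2}" "n3 \<in> {0,1,2}" "n4 \<in> {0,1,2}"
    unfolding n1_def n3_def n4_def insert_iff empty_iff by presburger+
  moreover have "cong_Z (\<alpha> 0) (of_int (n1 - n3) / of_int 3)" "cong_Z (\<alpha> 1) (of_int n1 / of_int 3)"
    "cong_Z (\<alpha> 2) (of_int (n1 + n4) / of_int 3)" "cong_Z (\<alpha> 3) (of_int n3 / of_int 3)"
    "cong_Z (\<alpha> 4) (of_int (- n4) / of_int 3)"
    unfolding \<alpha> by (intro cong_Z_of_int_divide dvd; simp)+
  then have "cong_Z (\<alpha> 0) (of_int n1 / 3 - of_int n3 / 3)" "cong_Z (\<alpha> 1) (of_int n1 / 3)"
    "cong_Z (\<alpha> 2) (of_int n1 / 3 + of_int n4 / 3)" "cong_Z (\<alpha> 3) (of_int n3 / 3)"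
    "cong_Z (\<alpha> 4) (- of_int n4 / 3)"
    by (simp_all add: add_divide_distrib diff_divide_distrib)
  ultimately show ?thesis by blast
qed

lemma A4_expansion_typeC:
  assumes "A4_expansion \<alpha> a b c" and "a 0 \<noteq> 0" "a 1 \<noteq> 0" "a 2 \<noteq> 0" "a 3 \<noteq> 0" "a 4 \<noteq> 0"
  shows "\<exists>n1\<in>{0,1,2,3,4::int}. \<exists>n2\<in>{0,1,2,3,4::int}. \<exists>n3\<in>{0,1,2,3,4::int}.
           cong_Z (\<alpha> 0) (of_int n1 / 5 + 2 * of_int n2 / 5 + 3 * of_int n3 / 5)
         \<and> cong_Z (\<alpha> 1) (of_int n1 / 5 + 2 * of_int n2 / 5 + of_int n3 / 5)
         \<and> cong_Z (\<alpha> 2) (of_int n1 / 5)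
         \<and> cong_Z (\<alpha> 3) (of_int n1 / 5 + of_int n2 / 5)
         \<and> cong_Z (\<alpha> 4) (of_int n1 / 5 + of_int n3 / 5)"
proof -
  note eqs = A4_expansion_first_equations[OF assms(1)]
  \<comment> \<open>All five values of the form vanish, and the sum of two neighbouring ones is the
    difference of two consecutive entries.\<close>
  have "a 1 = a 0" "a 2 = a 1" "a 3 = a 2" "a 4 = a 3"
    using eqs(1-5) assms(2-6) by algebra+
  then have a: "a 0 = 1/5" "a 1 = 1/5" "a 2 = 1/5" "a 3 = 1/5" "a 4 = 1/5"
    using eqs(6) by (simp_all add: eq_divide_eq mult.commute)
  have nz: "\<forall>k<5. a k = 0 \<longrightarrow> cyc_alt a k \<noteq> 0"
    unfolding all_less_5 using assms(2-6) by simp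
  note par = A4_expansion_parameters[OF assms(1) nz]
  obtain m where c: "\<And>j. j < 5 \<Longrightarrow> c j = of_int (m j)" and m: "m 0 + m 1 + m 2 + m 3 + m 4 = 0"
    using A4_expansion_integer_residues[OF assms(1)] by metis
  have cs: "c 0 = of_int (m 0)" "c 1 = of_int (m 1)" "c 2 = of_int (m 2)" "c 3 = of_int (m 3)"
    "c 4 = of_int (m 4)" by (rule c, simp)+
  define N2 where "N2 = 1 - (m 3 - m 4 + m 0 - m 1)"
  define N3 where "N3 = 1 - (m 4 - m 0 + m 1 - m 2)"
  define N4 where "N4 = 1 - (m 0 - m 1 + m 2 - m 3)"
  have \<alpha>: "\<alpha> 0 = of_int (1 - (m 1 - m 2 + m 3 - m 4)) / of_int 5"
    "\<alpha> 1 = of_int (1 - (m 2 - m 3 + m 4 - m 0)) / of_int 5"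
    "\<alpha> 2 = of_int N2 / of_int 5" "\<alpha> 3 = of_int N3 / of_int 5" "\<alpha> 4 = of_int N4 / of_int 5"
    unfolding N2_def N3_def N4_def
    by (subst par, simp, simp only: cyc_alt_simps a cs, simp add: field_simps)+
  \<comment> \<open>Since \<open>N2\<close>, \<open>N3\<close>, \<open>N4\<close> are five times
    \<alpha>(2), \<alpha>(3), \<alpha>(4), the last three congruences dictate these choices; the
    first two follow from the vanishing sum of the \<open>m j\<close>.\<close>
  define n1 where "n1 = N2 mod 5"
  define n2 where "n2 = (N3 - N2) mod 5"
  define n3 where "n3 = (N4 - N2) mod 5"
  have m0: "m 0 = - m 1 - m 2 - m 3 - m 4" using m by simp
  have "n1 = N2 - 5 * (N2 div 5)" "n2 = N3 - N2 - 5 * ((N3 - N2) div 5)"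
    "n3 = N4 - N2 - 5 * ((N4 - N2) div 5)"
    by (simp_all only: n1_def n2_def n3_def minus_mult_div_eq_mod)
  \<comment> \<open>Abstracting the quotients leaves linear relations without \<open>div\<close> for
    \<open>presburger\<close>.\<close>
  then obtain k1 k2 k3 where "n1 = N2 - 5 * k1" "n2 = N3 - N2 - 5 * k2" "n3 = N4 - N2 - 5 * k3"
    by blast
  then have dvd: "5 dvd (1 - (m 1 - m 2 + m 3 - m 4)) - (n1 + 2 * n2 + 3 * n3)"
    "5 dvd (1 - (m 2 - m 3 + m 4 - m 0)) - (n1 + 2 * n2 + n3)"
    "5 dvd N2 - n1" "5 dvd N3 - (n1 + n2)" "5 dvd N4 - (n1 + n3)"
    unfolding N2_def N3_def N4_def m0 by presburger+
  have "n1 \<in> {0,1,2,3,4}" "n2 \<in> {0,1,2,3,4}" "n3 \<in> {0,1,2,3,4}"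
    unfolding n1_def n2_def n3_def insert_iff empty_iff by presburger+
  moreover have "cong_Z (\<alpha> 0) (of_int (n1 + 2 * n2 + 3 * n3) / of_int 5)"
    "cong_Z (\<alpha> 1) (of_int (n1 + 2 * n2 + n3) / of_int 5)"
    "cong_Z (\<alpha> 2) (of_int n1 / of_int 5)" "cong_Z (\<alpha> 3) (of_int (n1 + n2) / of_int 5)"
    "cong_Z (\<alpha> 4) (of_int (n1 + n3) / of_int 5)"
    unfolding \<alpha> by (intro cong_Z_of_int_divide dvd; simp)+
  then have "cong_Z (\<alpha> 0) (of_int n1 / 5 + 2 * of_int n2 / 5 + 3 * of_int n3 / 5)"
    "cong_Z (\<alpha> 1) (of_int n1 / 5 + 2 * of_int n2 / 5 + of_int n3 / 5)"
    "cong_Z (\<alpha> 2) (of_int n1 / 5)" "cong_Z (\<alpha> 3) (of_int n1 / 5 + of_int n2 / 5)"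
    "cong_Z (\<alpha> 4) (of_int n1 / 5 + of_int n3 / 5)"
    by (simp_all add: add_divide_distrib diff_divide_distrib)
  ultimately show ?thesis by blast
qed

theorem theorem2p2:
  fixes \<alpha> :: "nat \<Rightarrow> complex" and f :: "nat \<Rightarrow> complex \<Rightarrow> complex"
  assumes sol: "A4_rational_solution \<alpha> f"
  shows "(typeA f \<longrightarrow> (\<forall>i<5. \<alpha> i \<in> \<int>))
    \<and> ((\<exists>i<5. typeB f i) \<longrightarrow>
        (\<exists>i<5. \<exists>n1\<in>{0,1,2::int}. \<exists>n3\<in>{0,1,2::int}. \<exists>n4\<in>{0,1,2::int}.
           cong_Z (\<alpha> i) (of_int n1 / 3 - of_int n3 / 3)
         \<and> cong_Z (\<alpha> ((i+1) mod 5)) (of_int n1 / 3)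
         \<and> cong_Z (\<alpha> ((i+2) mod 5)) (of_int n1 / 3 + of_int n4 / 3)
         \<and> cong_Z (\<alpha> ((i+3) mod 5)) (of_int n3 / 3)
         \<and> cong_Z (\<alpha> ((i+4) mod 5)) (- of_int n4 / 3)))
    \<and> (typeC f \<longrightarrow>
        (\<exists>i<5. \<exists>n1\<in>{0,1,2,3,4::int}. \<exists>n2\<in>{0,1,2,3,4::int}. \<exists>n3\<in>{0,1,2,3,4::int}.
           cong_Z (\<alpha> i) (of_int n1 / 5 + 2 * of_int n2 / 5 + 3 * of_int n3 / 5)
         \<and> cong_Z (\<alpha> ((i+1) mod 5)) (of_int n1 / 5 + 2 * of_int n2 / 5 + of_int n3 / 5)
         \<and> cong_Z (\<alpha> ((i+2) mod 5)) (of_int n1 / 5)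
         \<and> cong_Z (\<alpha> ((i+3) mod 5)) (of_int n1 / 5 + of_int n2 / 5)
         \<and> cong_Z (\<alpha> ((i+4) mod 5)) (of_int n1 / 5 + of_int n3 / 5)))"
proof -
  obtain a b c where ex: "A4_expansion \<alpha> a b c" and pole: "\<forall>j<5. pole_inf (f j) \<longleftrightarrow> a j \<noteq> 0"
    using A4_expansion_exists[OF sol] by blast
  note rot = A4_expansion_rotate[OF ex]
  have pole': "pole_inf (f ((i + k) mod 5)) \<longleftrightarrow> a ((i + k) mod 5) \<noteq> 0" for i k
    using pole by simp
  have A: "\<alpha> j \<in> \<int>" if "typeA f" "j < 5" for j
  proof -
    from \<open>typeA f\<close> obtain i where i: "i < 5" and ty: "typeA1 f i \<or> typeA2 f i"
      by (auto simp: typeA_def)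
    have "\<alpha> ((i + k) mod 5) \<in> \<int>" if "k < 5" for k
      using ty
    proof
      assume "typeA1 f i"
      then have "\<forall>k\<in>{1,2,3,4}. a ((i + k) mod 5) = 0" unfolding typeA1_def pole' not_not ..
      then show ?thesis
        by (intro A4_expansion_typeA1[OF rot[OF i] _ _ _ _ that]) blast+
    next
      assume "typeA2 f i"
      then have "\<forall>k\<in>{0,1,3}. a ((i + k) mod 5) \<noteq> 0" "\<forall>k\<in>{2,4}. a ((i + k) mod 5) = 0"
        unfolding typeA2_def pole' not_not by blast+
      then show ?thesis
        by (intro A4_expansion_typeA2[OF rot[OF i] _ _ _ _ _ that]) blast+
    qed
    \<comment> \<open>The shift that carries \<open>i\<close> to \<open>j\<close>; adding 5 avoids
      truncated subtraction of naturals.\<close>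
    from this[of "(j + 5 - i) mod 5"] have "\<alpha> ((i + (j + 5 - i)) mod 5) \<in> \<int>"
      by (simp only: mod_add_right_eq)
    then show ?thesis using i \<open>j < 5\<close> by simp
  qed
  have B: "\<exists>n1\<in>{0,1,2::int}. \<exists>n3\<in>{0,1,2::int}. \<exists>n4\<in>{0,1,2::int}.
           cong_Z (\<alpha> i) (of_int n1 / 3 - of_int n3 / 3)
         \<and> cong_Z (\<alpha> ((i+1) mod 5)) (of_int n1 / 3)
         \<and> cong_Z (\<alpha> ((i+2) mod 5)) (of_int n1 / 3 + of_int n4 / 3)
         \<and> cong_Z (\<alpha> ((i+3) mod 5)) (of_int n3 / 3)
         \<and> cong_Z (\<alpha> ((i+4) mod 5)) (- of_int n4 / 3)" if i: "i < 5" and "typeB f i" for i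
  proof -
    have "\<forall>k\<in>{0,1,2}. a ((i + k) mod 5) \<noteq> 0" "\<forall>k\<in>{3,4}. a ((i + k) mod 5) = 0"
      using \<open>typeB f i\<close> unfolding typeB_def pole' not_not by blast+
    then have "a ((i + 0) mod 5) \<noteq> 0" "a ((i + 1) mod 5) \<noteq> 0" "a ((i + 2) mod 5) \<noteq> 0"
      "a ((i + 3) mod 5) = 0" "a ((i + 4) mod 5) = 0" by blast+
    note A4_expansion_typeB[OF rot[OF i] this]
    then show ?thesis using i by (simp only: add_0_right mod_less)
  qed
  have C: "\<exists>n1\<in>{0,1,2,3,4::int}. \<exists>n2\<in>{0,1,2,3,4::int}. \<exists>n3\<in>{0,1,2,3,4::int}.
           cong_Z (\<alpha> 0) (of_int n1 / 5 + 2 * of_int n2 / 5 + 3 * of_int n3 / 5)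
         \<and> cong_Z (\<alpha> 1) (of_int n1 / 5 + 2 * of_int n2 / 5 + of_int n3 / 5)
         \<and> cong_Z (\<alpha> 2) (of_int n1 / 5)
         \<and> cong_Z (\<alpha> 3) (of_int n1 / 5 + of_int n2 / 5)
         \<and> cong_Z (\<alpha> 4) (of_int n1 / 5 + of_int n3 / 5)" if "typeC f"
    using that pole unfolding typeC_def by (intro A4_expansion_typeC[OF ex]) simp_all
  have mods: "(0 + 1) mod 5 = (1::nat)" "(0 + 2) mod 5 = (2::nat)" "(0 + 3) mod 5 = (3::nat)"
    "(0 + 4) mod 5 = (4::nat)" by simp_all
  show ?thesis
  proof (intro conjI impI)
    show "\<forall>i<5. \<alpha> i \<in> \<int>" if "typeA f"
      using A that by blast
  next
    assume "\<exists>i<5. typeB f i"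
    then obtain i where "i < 5" "typeB f i" by blast
    with B[OF this] show "\<exists>i<5. \<exists>n1\<in>{0,1,2::int}. \<exists>n3\<in>{0,1,2::int}. \<exists>n4\<in>{0,1,2::int}.
           cong_Z (\<alpha> i) (of_int n1 / 3 - of_int n3 / 3)
         \<and> cong_Z (\<alpha> ((i+1) mod 5)) (of_int n1 / 3)
         \<and> cong_Z (\<alpha> ((i+2) mod 5)) (of_int n1 / 3 + of_int n4 / 3)
         \<and> cong_Z (\<alpha> ((i+3) mod 5)) (of_int n3 / 3)
         \<and> cong_Z (\<alpha> ((i+4) mod 5)) (- of_int n4 / 3)"
      by (intro exI[of _ i] conjI)
  next
    assume "typeC f"
    show "\<exists>i<5. \<exists>n1\<in>{0,1,2,3,4::int}. \<exists>n2\<in>{0,1,2,3,4::int}. \<exists>n3\<in>{0,1,2,3,4::int}.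
           cong_Z (\<alpha> i) (of_int n1 / 5 + 2 * of_int n2 / 5 + 3 * of_int n3 / 5)
         \<and> cong_Z (\<alpha> ((i+1) mod 5)) (of_int n1 / 5 + 2 * of_int n2 / 5 + of_int n3 / 5)
         \<and> cong_Z (\<alpha> ((i+2) mod 5)) (of_int n1 / 5)
         \<and> cong_Z (\<alpha> ((i+3) mod 5)) (of_int n1 / 5 + of_int n2 / 5)
         \<and> cong_Z (\<alpha> ((i+4) mod 5)) (of_int n1 / 5 + of_int n3 / 5)"
      \<comment> \<open>Type C singles out no index, so index 0 is a valid witness.\<close>
      by (rule exI[of _ 0], unfold mods, rule conjI[OF _ C[OF \<open>typeC f\<close>]]) simp
  qed
qed

end
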